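(* Let $\eta$ be the IF sentence $$\forall x\big(\forall y(\exists u/\{x\})\epsilon_1\lor\forall z(\exists v/\{x\})\epsilon_2\big),$$ where $\epsilon_1 := (A(x)\land\mathcal{B}(y))\to(u\neq x\land R_\in(u,y))$ and $\epsilon_2 := (A(x)\land\mathcal{B}(z))\to(v\neq x\land R_\in(v,z))$. For every suitable structure $M$, $M\models\eta$ iff $M$ encodes a "yes" instance of SET SPLITTING.
   Context: IF team semantics: a team is a set of assignments with common finite domain; quantifier-free formulas ($\to$ classical) hold in a team iff in every assignment; $\psi\lor\chi$ holds in $X$ iff $X=Y\cup Z$ with $Y\models\psi$, $Z\models\chi$; $\forall v\psi$ in $X$ iff $X[M/v]=\{s(a/v):s\in X,a\in M\}\models\psi$; $(\exists v/V)\psi$ in $X$ iff $\{s(F(s)/v):s\in X\}\models\psi$ for some $V$-uniform $F:X\to M$ ($F(s)=F(s')$ whenever $s,s'$ agree outside $V$). $M\models\varphi$ iff $M,\{\emptyset\}\models\varphi$. SET SPLITTING (restricted): input a set $A$ and a family $\mathcal{B}\subseteq\wp(A)$ with every $B\in\mathcal{B}$ of cardinality at least 2; "yes" iff there is a partition $\{U,V\}$ of $A$ with $B\cap U\neq\emptyset$ and $B\cap V\neq\emptyset$ for all $B\in\mathcal{B}$. A suitable structure encoding $(A,\mathcal{B})$ has domain $A\cup\mathcal{B}$, unary predicates $A$ and $\mathcal{B}$ interpreted as these sets, and a binary relation $R_\in$ with $(a,B)\in R_\in$ iff $a\in A$, $B\in\mathcal{B}$ and $a\in B$. *)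

theory Defs
  imports Main
begin

section \<open>Independence-friendly logic with team semantics\<close>

type_synonym var = string

datatype 'r qf =
    Eq var var
  | Rel 'r "var list"
  | Not "'r qf"
  | Conj "'r qf" "'r qf"
  | Disj "'r qf" "'r qf"
  | Imp "'r qf" "'r qf"

text \<open>\<open>Ex v W \<psi>\<close> is the slashed quantifier $(\exists v/W)\psi$; the plain existential
  quantifier is the case of empty \<open>W\<close>.\<close>

datatype 'r if_formula =
    QF "'r qf"
  | Or "'r if_formula" "'r if_formula"
  | All var "'r if_formula"
  | Ex var "var set" "'r if_formula"

datatype ('r, 'm) fo_struct =
  Struct (Dom: "'m set") (Interp: "'r \<Rightarrow> 'm list set")

type_synonym 'm assignment = "var \<Rightarrow> 'm option"

definition is_team :: "('r, 'm) fo_struct \<Rightarrow> 'm assignment set \<Rightarrow> bool" where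
  "is_team M X \<longleftrightarrow> (\<exists>D. finite D \<and> (\<forall>s\<in>X. dom s = D \<and> ran s \<subseteq> Dom M))"

text \<open>Only meaningful when all variables of the formula are in the domain of \<open>s\<close>
  (\<open>the None\<close> is unspecified); evaluating a sentence in the team containing just the empty
  assignment never leaves this case.\<close>

fun qf_sat :: "('r, 'm) fo_struct \<Rightarrow> 'm assignment \<Rightarrow> 'r qf \<Rightarrow> bool" where
  "qf_sat M s (Eq x y) \<longleftrightarrow> the (s x) = the (s y)"
| "qf_sat M s (Rel r xs) \<longleftrightarrow> map (\<lambda>x. the (s x)) xs \<in> Interp M r"
| "qf_sat M s (Not \<phi>) \<longleftrightarrow> \<not> qf_sat M s \<phi>"
| "qf_sat M s (Conj \<phi> \<psi>) \<longleftrightarrow> qf_sat M s \<phi> \<and> qf_sat M s \<psi>"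
| "qf_sat M s (Disj \<phi> \<psi>) \<longleftrightarrow> qf_sat M s \<phi> \<or> qf_sat M s \<psi>"
| "qf_sat M s (Imp \<phi> \<psi>) \<longleftrightarrow> (qf_sat M s \<phi> \<longrightarrow> qf_sat M s \<psi>)"

definition duplicate :: "'m set \<Rightarrow> var \<Rightarrow> 'm assignment set \<Rightarrow> 'm assignment set" where
  "duplicate D v X = {s(v \<mapsto> a) | s a. s \<in> X \<and> a \<in> D}"

definition supplement :: "('m assignment \<Rightarrow> 'm) \<Rightarrow> var \<Rightarrow> 'm assignment set \<Rightarrow> 'm assignment set" where
  "supplement F v X = {s(v \<mapsto> F s) | s. s \<in> X}"

definition uniform :: "var set \<Rightarrow> 'm assignment set \<Rightarrow> ('m assignment \<Rightarrow> 'm) \<Rightarrow> bool" where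
  "uniform W X F \<longleftrightarrow>
    (\<forall>s\<in>X. \<forall>s'\<in>X. (\<forall>w. w \<notin> W \<longrightarrow> s w = s' w) \<longrightarrow> F s = F s')"

fun team_sat :: "('r, 'm) fo_struct \<Rightarrow> 'm assignment set \<Rightarrow> 'r if_formula \<Rightarrow> bool" where
  "team_sat M X (QF \<phi>) \<longleftrightarrow> (\<forall>s\<in>X. qf_sat M s \<phi>)"
| "team_sat M X (Or \<psi> \<chi>) \<longleftrightarrow> (\<exists>Y Z. X = Y \<union> Z \<and> team_sat M Y \<psi> \<and> team_sat M Z \<chi>)"
| "team_sat M X (All v \<psi>) \<longleftrightarrow> team_sat M (duplicate (Dom M) v X) \<psi>"
| "team_sat M X (Ex v W \<psi>) \<longleftrightarrow>
    (\<exists>F. F ` X \<subseteq> Dom M \<and> uniform W X F \<and> team_sat M (supplement F v X) \<psi>)"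

definition models :: "('r, 'm) fo_struct \<Rightarrow> 'r if_formula \<Rightarrow> bool" where
  "models M \<phi> \<longleftrightarrow> team_sat M {Map.empty} \<phi>"

text \<open>Evaluating a sentence only visits teams.\<close>

lemma is_team_empty_assignment: "is_team M {Map.empty}"
  by (auto simp: is_team_def)

lemma is_team_subset: "is_team M X \<Longrightarrow> Y \<subseteq> X \<Longrightarrow> is_team M Y"
  unfolding is_team_def by (meson subsetD)

lemma ran_upd_subset: "ran s \<subseteq> D \<Longrightarrow> a \<in> D \<Longrightarrow> ran (s(v \<mapsto> a)) \<subseteq> D"
  unfolding ran_def fun_upd_apply by (smt (verit) mem_Collect_eq option.inject subset_iff)

lemma is_team_duplicate:
  assumes "is_team M X"
  shows "is_team M (duplicate (Dom M) v X)"
proof -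
  obtain D where "finite D" and D: "\<forall>s\<in>X. dom s = D \<and> ran s \<subseteq> Dom M"
    using assms unfolding is_team_def by (elim exE conjE)
  show ?thesis
    unfolding is_team_def
  proof (intro exI[of _ "insert v D"] conjI ballI)
    fix t assume "t \<in> duplicate (Dom M) v X"
    then obtain s a where t: "t = s(v \<mapsto> a)" "s \<in> X" "a \<in> Dom M"
      by (auto simp: duplicate_def)
    show "dom t = insert v D" using t D by simp
    show "ran t \<subseteq> Dom M" unfolding t(1) using t D by (intro ran_upd_subset) auto
  qed (use \<open>finite D\<close> in simp)
qed

lemma is_team_supplement:
  assumes "is_team M X" and "F ` X \<subseteq> Dom M"
  shows "is_team M (supplement F v X)"
proof (rule is_team_subset[OF is_team_duplicate[OF assms(1), of v]])
  show "supplement F v X \<subseteq> duplicate (Dom M) v X"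
    using assms(2) by (auto simp: supplement_def duplicate_def)
qed


section \<open>Set splitting\<close>

text \<open>The cardinality condition is spelled out because \<open>card\<close> is \<open>0\<close> on infinite sets.\<close>

definition splitting_instance :: "'a set \<Rightarrow> 'a set set \<Rightarrow> bool" where
  "splitting_instance A \<B> \<longleftrightarrow> \<B> \<subseteq> Pow A \<and> (\<forall>B\<in>\<B>. infinite B \<or> 2 \<le> card B)"

text \<open>The parts \<open>U\<close> and \<open>V\<close> may be empty. This matters only for the empty family, which is
  thus always split: a nonempty family forces both parts to be nonempty.\<close>

definition splittable :: "'a set \<Rightarrow> 'a set set \<Rightarrow> bool" where
  "splittable A \<B> \<longleftrightarrow>
    (\<exists>U V. U \<union> V = A \<and> U \<inter> V = {} \<and> (\<forall>B\<in>\<B>. B \<inter> U \<noteq> {} \<and> B \<inter> V \<noteq> {}))"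

datatype sym = ASym | BSym | InSym

text \<open>The domain is to be $A \cup \mathcal{B}$, whose two parts have different types here.
  They are therefore injected into the type of the structure by \<open>i\<close> and \<open>j\<close>, i.e. structures are
  taken up to isomorphism. The images may overlap, just as \<open>A\<close> and \<open>\<B>\<close> may as
  untyped sets.\<close>

definition encodes :: "(sym, 'm) fo_struct \<Rightarrow> 'a set \<Rightarrow> 'a set set \<Rightarrow> bool" where
  "encodes M A \<B> \<longleftrightarrow> (\<exists>i j. inj_on i A \<and> inj_on j \<B> \<and>
     Dom M = i ` A \<union> j ` \<B> \<and>
     Interp M ASym = {[i a] | a. a \<in> A} \<and>
     Interp M BSym = {[j B] | B. B \<in> \<B>} \<and>
     Interp M InSym = {[i a, j B] | a B. a \<in> A \<and> B \<in> \<B> \<and> a \<in> B})"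

definition eps1 :: "sym qf" where
  "eps1 = Imp (Conj (Rel ASym [''x'']) (Rel BSym [''y'']))
              (Conj (Not (Eq ''u'' ''x'')) (Rel InSym [''u'', ''y'']))"

definition eps2 :: "sym qf" where
  "eps2 = Imp (Conj (Rel ASym [''x'']) (Rel BSym [''z'']))
              (Conj (Not (Eq ''v'' ''x'')) (Rel InSym [''v'', ''z'']))"

definition eta :: "sym if_formula" where
  "eta = All ''x'' (Or (All ''y'' (Ex ''u'' {''x''} (QF eps1)))
                       (All ''z'' (Ex ''v'' {''x''} (QF eps2))))"

end

theory Submission
  imports Defs
begin

text \<open>A team of assignments for the single variable \<open>x\<close> is a subset \<open>P\<close> of the domain. The subformula
  $\forall y(\exists u/\{x\})\epsilon_1$ holds in it iff one function of \<open>y\<close> alone picks from every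
  \<open>B\<close> an element differing from all elements of \<open>P \<inter> A\<close>, i.e. iff every \<open>B\<close>
  meets \<open>A - P\<close>. The disjunction covers the domain by two sets \<open>P\<close> and \<open>Q\<close>, and the disjoint sets
  \<open>A - P\<close> and \<open>A - Q\<close> then both meet every \<open>B\<close>;
  conversely a splitting of \<open>A\<close> into \<open>U\<close> and \<open>V\<close> is realized by \<open>P = U\<close> and its complement \<open>Q\<close>.\<close>

lemma duplicate_empty: "duplicate D x {Map.empty} = (\<lambda>m. [x \<mapsto> m]) ` D"
  by (auto simp: duplicate_def)

lemma duplicate_single:
  "duplicate D y ((\<lambda>m. [x \<mapsto> m]) ` P) = {[x \<mapsto> m, y \<mapsto> b] | m b. m \<in> P \<and> b \<in> D}"
  by (auto simp: duplicate_def)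

text \<open>Uniformity over \<open>{x}\<close> forces the value for \<open>u\<close> to be the same
  for all assignments that agree on \<open>y\<close>, so a function on assignments amounts to a
  function on the domain. As \<open>x \<noteq> y\<close>, the value of \<open>y\<close> stays
  visible to it.\<close>

lemma team_sat_All_Ex_iff:
  assumes "x \<noteq> y"
  shows "team_sat M ((\<lambda>m. [x \<mapsto> m]) ` P) (All y (Ex u {x} (QF \<phi>))) \<longleftrightarrow>
    (\<exists>f. f ` Dom M \<subseteq> Dom M \<and>
         (\<forall>m\<in>P. \<forall>b\<in>Dom M. qf_sat M [x \<mapsto> m, y \<mapsto> b, u \<mapsto> f b] \<phi>))"
    (is "?L \<longleftrightarrow> ?R")
proof
  let ?X = "{[x \<mapsto> m, y \<mapsto> b] | m b. m \<in> P \<and> b \<in> Dom M}"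
  assume ?L
  then obtain F where F: "F ` ?X \<subseteq> Dom M" "uniform {x} ?X F"
    and sat: "\<And>s. s \<in> supplement F u ?X \<Longrightarrow> qf_sat M s \<phi>"
    by (auto simp: duplicate_single)
  show ?R
  proof (cases "P = {}")
    case True
    \<comment> \<open>The empty team determines no value of \<open>f\<close>, so any self-map of the
      domain will do.\<close>
    then show ?thesis by (intro exI[of _ id]) simp
  next
    case False
    then obtain m0 where m0: "m0 \<in> P" by blast
    \<comment> \<open>Freeze \<open>x\<close> at \<open>m0\<close>; by uniformity the choice of
      \<open>m0\<close> does not affect the value.\<close>
    define f where "f b = F [x \<mapsto> m0, y \<mapsto> b]" for b
    have eq: "F [x \<mapsto> m, y \<mapsto> b] = f b" if "m \<in> P" "b \<in> Dom M" for m b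
    proof -
      have "[x \<mapsto> m, y \<mapsto> b] \<in> ?X" "[x \<mapsto> m0, y \<mapsto> b] \<in> ?X"
        using that m0 by blast+
      moreover have "\<forall>w. w \<notin> {x} \<longrightarrow> [x \<mapsto> m, y \<mapsto> b] w = [x \<mapsto> m0, y \<mapsto> b] w"
        by simp
      ultimately show ?thesis
        using F(2) unfolding uniform_def f_def by blast
    qed
    have "f ` Dom M \<subseteq> Dom M"
      using F(1) m0 unfolding f_def by blast
    moreover have "qf_sat M [x \<mapsto> m, y \<mapsto> b, u \<mapsto> f b] \<phi>" if "m \<in> P" "b \<in> Dom M" for m b
    proof (rule sat)
      show "[x \<mapsto> m, y \<mapsto> b, u \<mapsto> f b] \<in> supplement F u ?X"
        unfolding supplement_def eq[OF that, symmetric] using that by blast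
    qed
    ultimately show ?thesis by blast
  qed
next
  assume ?R
  then obtain f where f: "f ` Dom M \<subseteq> Dom M"
    "\<forall>m\<in>P. \<forall>b\<in>Dom M. qf_sat M [x \<mapsto> m, y \<mapsto> b, u \<mapsto> f b] \<phi>"
    by (elim exE conjE)
  have "uniform {x} {[x \<mapsto> m, y \<mapsto> b] | m b. m \<in> P \<and> b \<in> Dom M} (\<lambda>s. f (the (s y)))"
    unfolding uniform_def
  proof (intro ballI impI)
    fix s s' :: "'b assignment"
    assume "\<forall>w. w \<notin> {x} \<longrightarrow> s w = s' w"
    then have "s y = s' y" using assms by simp
    then show "f (the (s y)) = f (the (s' y))" by simp
  qed
  then show ?L
    unfolding team_sat.simps duplicate_single
  proof (intro exI[of _ "\<lambda>s. f (the (s y))"] conjI ballI)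
    fix s assume "s \<in> supplement (\<lambda>s. f (the (s y))) u
      {[x \<mapsto> m, y \<mapsto> b] | m b. m \<in> P \<and> b \<in> Dom M}"
    then obtain m b where "s = [x \<mapsto> m, y \<mapsto> b, u \<mapsto> f b]" "m \<in> P" "b \<in> Dom M"
      unfolding supplement_def by auto
    then show "qf_sat M s \<phi>" using f(2) by simp
  qed (use f(1) in auto)
qed

text \<open>The value chosen for \<open>j B\<close> codes an element of \<open>B\<close>. Were its
  code in \<open>P\<close>, it would also occur as a value of \<open>x\<close>, against
  \<open>u \<noteq> x\<close>. Conversely, an element coded outside \<open>P\<close> serves all
  values of \<open>x\<close> at once. The variables are kept generic so that both disjuncts are
  covered.\<close>

lemma team_sat_choice_iff:
  assumes "inj_on j \<B>" and Dom: "Dom M = i ` A \<union> j ` \<B>"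
    and A: "Interp M ASym = {[i a] | a. a \<in> A}"
    and B: "Interp M BSym = {[j B] | B. B \<in> \<B>}"
    and In: "Interp M InSym = {[i a, j B] | a B. a \<in> A \<and> B \<in> \<B> \<and> a \<in> B}"
    and sub: "\<B> \<subseteq> Pow A" and nonempty: "{} \<notin> \<B>"
    and distinct: "x \<noteq> y" "x \<noteq> u" "y \<noteq> u"
  shows "team_sat M ((\<lambda>m. [x \<mapsto> m]) ` P)
      (All y (Ex u {x} (QF (Imp (Conj (Rel ASym [x]) (Rel BSym [y]))
                                (Conj (Not (Eq u x)) (Rel InSym [u, y])))))) \<longleftrightarrow>
    (\<forall>B\<in>\<B>. \<exists>a\<in>B. i a \<notin> P)" (is "?L \<longleftrightarrow> ?R")
proof -
  have iff: "?L \<longleftrightarrow> (\<exists>f. f ` Dom M \<subseteq> Dom M \<and> (\<forall>m\<in>P. \<forall>b\<in>Dom M.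
      [m] \<in> Interp M ASym \<longrightarrow> [b] \<in> Interp M BSym \<longrightarrow> f b \<noteq> m \<and> [f b, b] \<in> Interp M InSym))"
    unfolding team_sat_All_Ex_iff[OF distinct(1)] using distinct by (simp add: imp_conjL)
  show ?thesis
  proof
    assume ?L
    then obtain f where f: "\<forall>m\<in>P. \<forall>b\<in>Dom M. [m] \<in> Interp M ASym \<longrightarrow>
        [b] \<in> Interp M BSym \<longrightarrow> f b \<noteq> m \<and> [f b, b] \<in> Interp M InSym"
      unfolding iff by (elim exE conjE)
    show ?R
    proof (rule ballI, rule ccontr)
      fix B assume "B \<in> \<B>" and "\<not> (\<exists>a\<in>B. i a \<notin> P)"
      then have all: "\<And>a. a \<in> B \<Longrightarrow> i a \<in> P" by blast
      have choice: "f (j B) \<noteq> i a \<and> [f (j B), j B] \<in> Interp M InSym" if "a \<in> B" for a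
      proof (rule f[rule_format])
        show "i a \<in> P" using all that .
        have "a \<in> A" using that \<open>B \<in> \<B>\<close> sub by blast
        then show "[i a] \<in> Interp M ASym" unfolding A by blast
        show "j B \<in> Dom M" "[j B] \<in> Interp M BSym"
          unfolding Dom B using \<open>B \<in> \<B>\<close> by blast+
      qed
      \<comment> \<open>Some \<open>x\<close> in \<open>P\<close> satisfying \<open>A\<close> is
        required before the implication constrains \<open>f (j B)\<close> at all; any element of
        \<open>B\<close> provides one.\<close>
      obtain a where "a \<in> B" using nonempty \<open>B \<in> \<B>\<close> by (metis equals0I)
      then have "[f (j B), j B] \<in> Interp M InSym" using choice by blast
      then obtain a' B' where "f (j B) = i a'" "j B = j B'" "B' \<in> \<B>" "a' \<in> B'"
        by (auto simp: In)
      \<comment> \<open>Injectivity of \<open>j\<close> gives \<open>B' = B\<close>, so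
        \<open>choice\<close> applies to \<open>a'\<close> itself and contradicts
        \<open>f (j B) = i a'\<close>.\<close>
      then show False
        using choice \<open>inj_on j \<B>\<close> \<open>B \<in> \<B>\<close> by (metis inj_onD)
    qed
  next
    assume ?R
    then obtain g where g: "\<And>B. B \<in> \<B> \<Longrightarrow> g B \<in> B \<and> i (g B) \<notin> P" by metis
    \<comment> \<open>Off the codes of sets the matrix is vacuous; the value \<open>b\<close> there
      only keeps \<open>f\<close> inside the domain.\<close>
    define f where "f b = (if b \<in> j ` \<B> then i (g (the_inv_into \<B> j b)) else b)" for b
    have f: "f (j B) = i (g B)" if "B \<in> \<B>" for B
      using that \<open>inj_on j \<B>\<close> by (simp add: f_def the_inv_into_f_f)
    have "f b \<in> Dom M" if "b \<in> Dom M" for b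
    proof (cases "b \<in> j ` \<B>")
      case True
      then obtain B where "b = j B" "B \<in> \<B>" by blast
      moreover from this have "g B \<in> A" using g sub by blast
      ultimately show ?thesis using f by (simp add: Dom)
    next
      case False
      then show ?thesis using that by (simp add: f_def)
    qed
    moreover have "f b \<noteq> m \<and> [f b, b] \<in> Interp M InSym"
      if "m \<in> P" "[b] \<in> Interp M BSym" for m b
    proof -
      obtain B where bB: "b = j B" "B \<in> \<B>" using \<open>[b] \<in> Interp M BSym\<close> by (auto simp: B)
      then have gB: "f b = i (g B)" "g B \<in> B" "i (g B) \<notin> P" "g B \<in> A"
        using f g sub by auto
      then have "[f b, b] \<in> Interp M InSym"
        unfolding In bB(1) using bB(2) by auto
      then show ?thesis
        using gB(1,3) \<open>m \<in> P\<close> by auto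
    qed
    ultimately show ?L
      unfolding iff by (intro exI[of _ f]) auto
  qed
qed

theorem mainTheorem11:
  fixes M :: "(sym, 'm) fo_struct" and A :: "'a set" and \<B> :: "'a set set"
  assumes "splitting_instance A \<B>"
    and "encodes M A \<B>"
  shows "models M eta \<longleftrightarrow> splittable A \<B>"
proof -
  have sub: "\<B> \<subseteq> Pow A" and nonempty: "{} \<notin> \<B>"
    using assms(1) by (auto simp: splitting_instance_def)
  obtain i j where enc: "inj_on i A" "inj_on j \<B>" "Dom M = i ` A \<union> j ` \<B>"
    "Interp M ASym = {[i a] | a. a \<in> A}"
    "Interp M BSym = {[j B] | B. B \<in> \<B>}"
    "Interp M InSym = {[i a, j B] | a B. a \<in> A \<and> B \<in> \<B> \<and> a \<in> B}"
    using assms(2) unfolding encodes_def by (elim exE conjE)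
  let ?t = "\<lambda>P. (\<lambda>m. [''x'' \<mapsto> m]) ` P"
  let ?\<psi>1 = "All ''y'' (Ex ''u'' {''x''} (QF eps1))"
  let ?\<psi>2 = "All ''z'' (Ex ''v'' {''x''} (QF eps2))"
  have sat1: "team_sat M (?t P) ?\<psi>1 \<longleftrightarrow> (\<forall>B\<in>\<B>. \<exists>a\<in>B. i a \<notin> P)" for P
    unfolding eps1_def by (rule team_sat_choice_iff[OF enc(2-6) sub nonempty]) auto
  have sat2: "team_sat M (?t P) ?\<psi>2 \<longleftrightarrow> (\<forall>B\<in>\<B>. \<exists>a\<in>B. i a \<notin> P)" for P
    unfolding eps2_def by (rule team_sat_choice_iff[OF enc(2-6) sub nonempty]) auto
  \<comment> \<open>Only the outer quantifier and the disjunction are unfolded, so that the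
    disjuncts keep the shape of \<open>sat1\<close> and \<open>sat2\<close>.\<close>
  have eta: "models M eta \<longleftrightarrow>
      (\<exists>Y Z. ?t (Dom M) = Y \<union> Z \<and> team_sat M Y ?\<psi>1 \<and> team_sat M Z ?\<psi>2)"
    unfolding models_def eta_def team_sat.simps(3)[of M "{Map.empty}"] duplicate_empty
      team_sat.simps(2) ..
  show ?thesis
  proof
    assume "models M eta"
    then obtain Y Z where YZ: "?t (Dom M) = Y \<union> Z" "team_sat M Y ?\<psi>1" "team_sat M Z ?\<psi>2"
      unfolding eta by blast
    have "Y \<subseteq> ?t (Dom M)" "Z \<subseteq> ?t (Dom M)" using YZ(1) by auto
    then obtain P Q where PQ: "Y = ?t P" "Z = ?t Q" by (meson subset_imageE)
    have "inj (\<lambda>m. [''x'' \<mapsto> m])"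
      by (rule injI) (metis fun_upd_same option.inject)
    then have cover: "Dom M = P \<union> Q"
      using YZ(1) unfolding PQ image_Un[symmetric] by (rule inj_image_eq_iff[THEN iffD1])
    have P: "\<forall>B\<in>\<B>. \<exists>a\<in>B. i a \<notin> P" and Q: "\<forall>B\<in>\<B>. \<exists>a\<in>B. i a \<notin> Q"
      using YZ(2,3) unfolding PQ sat1 sat2 by auto
    \<comment> \<open>The splitting is into the elements coded outside and inside \<open>P\<close>.
      An element coded outside \<open>Q\<close> lies in the second part, since \<open>P\<close> and
      \<open>Q\<close> cover the domain.\<close>
    have "B \<inter> {a\<in>A. i a \<notin> P} \<noteq> {} \<and> B \<inter> {a\<in>A. i a \<in> P} \<noteq> {}" if "B \<in> \<B>" for B
    proof -
      obtain a where a: "a \<in> B" "i a \<notin> P" using bspec[OF P \<open>B \<in> \<B>\<close>] by (elim bexE)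
      obtain b where b: "b \<in> B" "i b \<notin> Q" using bspec[OF Q \<open>B \<in> \<B>\<close>] by (elim bexE)
      have A: "a \<in> A" "b \<in> A" using a(1) b(1) that sub by auto
      then have "i b \<in> P" using enc(3) cover b(2) by auto
      with a b A show ?thesis by auto
    qed
    then show "splittable A \<B>"
      unfolding splittable_def
      by (intro exI[of _ "{a\<in>A. i a \<notin> P}"] exI[of _ "{a\<in>A. i a \<in> P}"]) blast
  next
    assume "splittable A \<B>"
    then obtain U V where UV: "U \<union> V = A" "U \<inter> V = {}"
      "\<forall>B\<in>\<B>. B \<inter> U \<noteq> {} \<and> B \<inter> V \<noteq> {}"
      unfolding splittable_def by blast
    have dis: "i a \<notin> i ` U" if "a \<in> V" for a
      using that UV enc(1) by (auto simp: inj_on_def)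
    have "team_sat M (?t (i ` U)) ?\<psi>1"
      unfolding sat1 using UV(3) dis by (metis disjoint_iff)
    \<comment> \<open>The roles swap: here an element of \<open>B \<inter> U\<close> is coded
      outside the subteam.\<close>
    moreover have "team_sat M (?t (Dom M - i ` U)) ?\<psi>2"
      unfolding sat2 using UV(3) by (metis DiffD2 disjoint_iff imageI)
    moreover have "?t (Dom M) = ?t (i ` U) \<union> ?t (Dom M - i ` U)"
      using UV(1) enc(3) by auto
    ultimately show "models M eta"
      unfolding eta by (intro exI conjI)
  qed
qed

end
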